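(* Let $G$ be a topological group, $(X,\mathscr U)$ a nonempty uniform space and $f\in C(G,X)$. Suppose there exists $M\subset X$ with $f(G)\subset M$ such that $M$ is complete and satisfies $(A_0)$. Then for $f$ the four properties ssap, LRssap, Lssap, Rssap are equivalent, and they are equivalent with $f\in AP(G,X)$.
   Context: No separation, countability or completeness axioms are assumed for $G$ or $X$ beyond those stated. $C(G,X)$ is the set of continuous $f:G\to X$ with the uniformity of uniform convergence on $G$ (basic vicinities $\{(f,g):(f(t),g(t))\in U\ \forall t\in G\}$, $U\in\mathscr U$); $C(G\times G,X)$ likewise, with uniform convergence on $G\times G$. $M\subset X$ is complete if each Cauchy net from $M$ converges to some $x\in M$. $M$ satisfies $(A_0)$ (von Neumann's countability axiom) if there exist $U_n\in\mathscr U$, $n\in\mathbb N$, with $(M\times M)\cap\bigcap_{n=1}^\infty U_n=(M\times M)\cap\bigcap_{U\in\mathscr U}U$. Translates: ${}_af(t)=f(at)$, $f_a(t)=f(ta)$, $f_{[a]}(s,t)=f(sat)$, $a,s,t\in G$. For $f\in C(G,X)$: Lssap means each sequence $({}_{s_n}f)_{n\in\mathbb N}$, $s_n\in G$, has a Cauchy subsequence in $C(G,X)$; Rssap means each sequence $(f_{s_n})_{n\in\mathbb N}$ has a Cauchy subsequence in $C(G,X)$; LRssap means Lssap and Rssap; ssap means each sequence $(f_{[s_n]})_{n\in\mathbb N}$ has a Cauchy subsequence in $C(G\times G,X)$. $AP(G,X)$ is the set of almost periodic functions. The paper defines almost periodicity by any one of a list of 25 properties it shows to be equivalent; one of them (Maak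 almost periodicity), used here as the definition, is: $f\in C(G,X)$ and for each $U\in\mathscr U$ there are $n\in\mathbb N$ and $A_1,\dots,A_n\subset G$ with $\bigcup_{j=1}^nA_j=G$ such that if $u,v\in A_k$ for some $k$, then $(f(sut),f(svt))\in U$ for all $s,t\in G$. *)

theory Defs
  imports "HOL-Analysis.Analysis"
begin

text \<open>
  The topological group \<open>G\<close> is a type of class \<^class>\<open>topological_group_add\<close>. This class assumes neither
  commutativity nor any separation axiom; it merely writes the group operation additively, so the
  product \<open>sat\<close> is \<open>s + a + t\<close>. The uniform space \<open>X\<close> is a type of class \<^class>\<open>uniform_space\<close>
  (not necessarily Hausdorff); a vicinity is a set \<open>U\<close> with
  \<open>eventually (\<lambda>p. p \<in> U) uniformity\<close>.
\<close>

definition vicinities :: "('x::uniform_space \<times> 'x) set set" where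
  "vicinities = {U. eventually (\<lambda>p. p \<in> U) uniformity}"

definition contfuns :: "('a::topological_space \<Rightarrow> 'x::topological_space) set" where
  "contfuns = {f. continuous_on UNIV f}"

definition basic_vicinity ::
    "('x::uniform_space \<times> 'x) set \<Rightarrow> (('a::topological_space \<Rightarrow> 'x) \<times> ('a \<Rightarrow> 'x)) set" where
  "basic_vicinity U = {(f, g). f \<in> contfuns \<and> g \<in> contfuns \<and> (\<forall>t. (f t, g t) \<in> U)}"

text \<open>
  The uniformity of uniform convergence on \<open>contfuns\<close>. It is kept separate from the type class
  \<^class>\<open>uniform_space\<close>, since the function type already carries the product topology.
\<close>

definition contfuns_uniformity ::
    "(('a::topological_space \<Rightarrow> 'x::uniform_space) \<times> ('a \<Rightarrow> 'x)) filter" where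
  "contfuns_uniformity = (INF U\<in>vicinities. principal (basic_vicinity U))"

text \<open>Same shape as the library's \<^const>\<open>Cauchy\<close>, for the uniformity above.\<close>

definition Cauchy_contfuns :: "(nat \<Rightarrow> 'a::topological_space \<Rightarrow> 'x::uniform_space) \<Rightarrow> bool" where
  "Cauchy_contfuns F \<longleftrightarrow>
     filtermap F sequentially \<times>\<^sub>F filtermap F sequentially \<le> contfuns_uniformity"

lemma Cauchy_contfuns_iff:
  "Cauchy_contfuns F \<longleftrightarrow> (\<forall>U\<in>vicinities. \<exists>N. \<forall>m\<ge>N. \<forall>n\<ge>N. (F m, F n) \<in> basic_vicinity U)"
  (is "?L = ?R")
proof
  assume L: ?L
  show ?R
  proof
    fix U :: "('b\<times>'b) set" assume U: "U \<in> vicinities"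
    have "filtermap F sequentially \<times>\<^sub>F filtermap F sequentially \<le> principal (basic_vicinity U)"
      using L U unfolding Cauchy_contfuns_def contfuns_uniformity_def le_INF_iff by blast
    then have "eventually (\<lambda>(m,n). (F m, F n) \<in> basic_vicinity U) (sequentially \<times>\<^sub>F sequentially)"
      by (simp add: le_principal prod_filtermap1 prod_filtermap2 eventually_filtermap case_prod_unfold)
    then show "\<exists>N. \<forall>m\<ge>N. \<forall>n\<ge>N. (F m, F n) \<in> basic_vicinity U"
      unfolding eventually_prod_sequentially by auto
  qed
next
  assume R: ?R
  then show ?L unfolding Cauchy_contfuns_def contfuns_uniformity_def le_INF_iff
    apply (simp add: le_principal prod_filtermap1 prod_filtermap2 eventually_filtermap case_prod_unfold eventually_prod_sequentially)
    by blast
qed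

definition has_Cauchy_subseq :: "(nat \<Rightarrow> 'a::topological_space \<Rightarrow> 'x::uniform_space) \<Rightarrow> bool" where
  "has_Cauchy_subseq F \<longleftrightarrow> (\<exists>r::nat \<Rightarrow> nat. strict_mono r \<and> Cauchy_contfuns (F \<circ> r))"

definition vN_countability :: "'x::uniform_space set \<Rightarrow> bool" where
  "vN_countability M \<longleftrightarrow>
     (\<exists>U :: nat \<Rightarrow> ('x \<times> 'x) set. (\<forall>n. U n \<in> vicinities) \<and>
        (M \<times> M) \<inter> (\<Inter>n. U n) = (M \<times> M) \<inter> \<Inter>vicinities)"

definition ltranslate :: "'g::topological_group_add \<Rightarrow> ('g \<Rightarrow> 'x) \<Rightarrow> 'g \<Rightarrow> 'x" where
  "ltranslate a f = (\<lambda>t. f (a + t))"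

definition rtranslate :: "'g::topological_group_add \<Rightarrow> ('g \<Rightarrow> 'x) \<Rightarrow> 'g \<Rightarrow> 'x" where
  "rtranslate a f = (\<lambda>t. f (t + a))"

definition mtranslate :: "'g::topological_group_add \<Rightarrow> ('g \<Rightarrow> 'x) \<Rightarrow> 'g \<times> 'g \<Rightarrow> 'x" where
  "mtranslate a f = (\<lambda>(s, t). f (s + a + t))"

definition Lssap :: "('g::topological_group_add \<Rightarrow> 'x::uniform_space) \<Rightarrow> bool" where
  "Lssap f \<longleftrightarrow> f \<in> contfuns \<and> (\<forall>s::nat \<Rightarrow> 'g. has_Cauchy_subseq (\<lambda>n. ltranslate (s n) f))"

definition Rssap :: "('g::topological_group_add \<Rightarrow> 'x::uniform_space) \<Rightarrow> bool" where
  "Rssap f \<longleftrightarrow> f \<in> contfuns \<and> (\<forall>s::nat \<Rightarrow> 'g. has_Cauchy_subseq (\<lambda>n. rtranslate (s n) f))"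

definition LRssap :: "('g::topological_group_add \<Rightarrow> 'x::uniform_space) \<Rightarrow> bool" where
  "LRssap f \<longleftrightarrow> Lssap f \<and> Rssap f"

definition ssap :: "('g::topological_group_add \<Rightarrow> 'x::uniform_space) \<Rightarrow> bool" where
  "ssap f \<longleftrightarrow> f \<in> contfuns \<and> (\<forall>s::nat \<Rightarrow> 'g. has_Cauchy_subseq (\<lambda>n. mtranslate (s n) f))"

text \<open>Almost periodic functions in the sense of Maak.\<close>

definition AP :: "('g::topological_group_add \<Rightarrow> 'x::uniform_space) set" where
  "AP = {f. f \<in> contfuns \<and>
     (\<forall>U\<in>vicinities. \<exists>(n::nat) (A :: nat \<Rightarrow> 'g set). (\<Union>j\<in>{1..n}. A j) = UNIV \<and>
        (\<forall>k\<in>{1..n}. \<forall>u\<in>A k. \<forall>v\<in>A k. \<forall>s t. (f (s + u + t), f (s + v + t)) \<in> U))}"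

end

theory Submission
  imports Defs "HOL-Library.Diagonal_Subsequence"
begin

text \<open>
  The central notion is that of a family of functions which is totally bounded for uniform
  convergence: for any vicinity the parameter set splits into finitely many classes within which
  the functions are uniformly close. Maak almost periodicity of \<open>f\<close> is total boundedness of the
  family of its two-sided translates. The equivalences follow from three observations.

  \<^item> A family in which each sequence has a Cauchy subsequence is totally bounded; otherwise one
    chooses an infinite sequence of pairwise distant members (\<open>totally_bounded_family_if_subseq\<close>).

  \<^item> If the left translates are totally bounded, so are the two-sided ones, and likewise for
    the right translates. Indeed \<open>f(s + u + t)\<close> is close to \<open>f(c + u + t)\<close> for one of finitely many
    representatives \<open>c\<close>, and for those finitely many \<open>c\<close> a common refinement of the translated
    partitions controls the dependence on \<open>u\<close> (\<open>totally_bounded_family_two_sided\<close>).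

  \<^item> For a totally bounded family a diagonal argument produces Cauchy subsequences as soon as
    countably many vicinities suffice to test uniform closeness on \<open>range f\<close>
    (\<open>subseq_if_totally_bounded_family\<close>). Here von Neumann's axiom and completeness enter.
    For vicinities \<open>U\<^sub>n\<close> as in the axiom one only knows the intersection of all of them on \<open>M\<close>, so
    a compactness argument is needed. Suppose that pairs in \<open>range f\<close> become close with respect to
    more and more of the \<open>U\<^sub>n\<close> without ever lying in some vicinity \<open>U\<close>. As \<open>range f\<close> is totally
    bounded and \<open>M\<close> is complete, they converge along an ultrafilter to a pair in \<open>M \<times> M\<close>. This
    limit pair lies in all \<open>U\<^sub>n\<close>, hence in every vicinity, and so some of the pairs do lie in \<open>U\<close>
    (\<open>countable_base_of_vN_countability\<close>).

  Thus \<open>AP\<close> implies ssap, ssap implies both one-sided properties by setting one variable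
  to \<open>0\<close>, and each one-sided property implies \<open>AP\<close>.
\<close>

section \<open>Vicinities and ultrafilters\<close>

lemma vicinity_refl: "U \<in> vicinities \<Longrightarrow> (x, x) \<in> U"
  unfolding vicinities_def using uniformity_refl by fastforce

text \<open>
  A third of \<open>U\<close>. Since vicinities contain the diagonal, the same \<open>V\<close> also serves where only two
  steps have to be chained.
\<close>

lemma vicinity_third:
  fixes U :: "('x::uniform_space \<times> 'x) set"
  assumes "U \<in> vicinities"
  obtains V where "V \<in> vicinities" "sym V" "V O V O V \<subseteq> U"
proof -
  have "eventually (\<lambda>p. p \<in> U) uniformity" using assms by (simp add: vicinities_def)
  then obtain D where D: "eventually D uniformity"
    and DU: "\<forall>x y z. D (x, y) \<longrightarrow> D (y, z) \<longrightarrow> (x, z) \<in> U" using uniformity_trans by blast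
  obtain E where E: "eventually E uniformity"
    and ED: "\<forall>x y z. E (x, y) \<longrightarrow> E (y, z) \<longrightarrow> D (x, z)" using uniformity_trans[OF D] by blast
  have E_D: "D (x, y)" if "E (x, y)" for x y using ED that uniformity_refl[OF E] by blast
  define V where "V = {(x, y). E (x, y) \<and> E (y, x)}"
  show thesis
  proof
    show "V \<in> vicinities"
      unfolding vicinities_def V_def mem_Collect_eq
      using eventually_conj[OF E uniformity_sym[OF E]] by (simp add: case_prod_unfold)
    show "sym V" by (auto simp: V_def sym_def)
    show "V O V O V \<subseteq> U"
    proof clarify
      fix x y z w assume "(x, y) \<in> V" "(y, z) \<in> V" "(z, w) \<in> V"
      then have "E (x, y)" "D (y, w)" using ED by (auto simp: V_def)
      then show "(x, w) \<in> U" using E_D DU by blast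
    qed
  qed
qed

lemma vicinity_Int_atMost:
  assumes "\<And>i. V i \<in> vicinities"
  shows "(\<Inter>i\<le>n::nat. V i) \<in> vicinities"
  using assms unfolding vicinities_def by (simp add: eventually_ball_finite)

lemma eventually_nhds_vicinity:
  assumes "U \<in> vicinities"
  shows "eventually (\<lambda>y. (x, y) \<in> U) (nhds x)"
  using assms unfolding vicinities_def eventually_nhds_uniformity
  by (auto elim!: eventually_mono)

text \<open>
  Zorn's lemma yields a minimal proper filter \<open>H\<close> below \<open>F\<close>. If \<open>H\<close> does not refute \<open>P\<close>, its
  restriction to \<open>P\<close> is still proper, and by minimality it is \<open>H\<close> itself.
\<close>

lemma ultrafilter_below:
  fixes F :: "'a filter"
  assumes "F \<noteq> bot"
  obtains H where "H \<le> F" "H \<noteq> bot" "\<And>P. eventually P H \<or> eventually (\<lambda>x. \<not> P x) H"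
proof -
  define A where "A = {H. H \<le> F \<and> H \<noteq> bot}"
  have "\<exists>m\<in>A. \<forall>a\<in>A. m \<ge> a \<longrightarrow> a = m"
  proof (rule predicate_Zorn)
    show "partial_order_on A (relation_of (\<ge>) A)"
      by (auto simp: partial_order_on_def preorder_on_def relation_of_def refl_on_def
          trans_def antisym_def)
    fix C assume C: "C \<in> Chains (relation_of (\<ge>) A)"
    then have CA: "C \<subseteq> A" and chain: "\<And>a b. a \<in> C \<Longrightarrow> b \<in> C \<Longrightarrow> a \<le> b \<or> b \<le> a"
      unfolding Chains_def relation_of_def by auto
    show "\<exists>u\<in>A. \<forall>a\<in>C. a \<ge> u"
    proof (cases "C = {}")
      case True
      then show ?thesis using assms by (auto simp: A_def)
    next
      case False
      have "\<exists>x\<in>C. x \<le> inf a b" if "a \<in> C" "b \<in> C" for a b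
        using chain[OF that] that by (auto intro: bexI[of _ a] bexI[of _ b])
      then have "eventually P (Inf C) \<longleftrightarrow> (\<exists>b\<in>C. eventually P b)" for P
        using False by (intro eventually_Inf_base)
      then have "Inf C \<noteq> bot"
        using CA unfolding A_def trivial_limit_def by blast
      moreover from False obtain c where "c \<in> C" by auto
      then have "Inf C \<le> F" using CA by (auto simp: A_def intro: Inf_lower2)
      ultimately show ?thesis by (intro bexI[of _ "Inf C"]) (auto simp: A_def intro: Inf_lower)
    qed
  qed
  then obtain H where H: "H \<le> F" "H \<noteq> bot"
    and least: "\<And>H'. H' \<le> F \<Longrightarrow> H' \<noteq> bot \<Longrightarrow> H' \<le> H \<Longrightarrow> H' = H" by (auto simp: A_def)
  have "eventually P H" if "\<not> eventually (\<lambda>x. \<not> P x) H" for P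
  proof -
    let ?H' = "inf H (principal {x. P x})"
    have "?H' \<noteq> bot" using that by (simp add: trivial_limit_def eventually_inf_principal)
    then have "?H' = H" using H by (intro least) (auto intro: le_infI1)
    moreover have "eventually P ?H'" by (simp add: eventually_inf_principal)
    ultimately show ?thesis by simp
  qed
  with H that show thesis by blast
qed

text \<open>
  Along an ultrafilter every function with values in a totally bounded set is Cauchy: one of the
  finitely many small pieces must contain almost all values.
\<close>

lemma ultrafilter_converges:
  fixes a :: "'i \<Rightarrow> 'x::uniform_space"
  assumes "H \<noteq> bot" and ultra: "\<And>P. eventually P H \<or> eventually (\<lambda>i. \<not> P i) H"
    and tb: "totally_bounded R" and aR: "\<And>i. a i \<in> R" and RM: "R \<subseteq> M" and M: "complete M"
  shows "\<exists>x\<in>M. \<forall>U\<in>vicinities. eventually (\<lambda>i. (x, a i) \<in> U) H"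
proof -
  have "cauchy_filter (filtermap a H)"
    unfolding cauchy_filter_def
  proof (rule filter_leI)
    fix P :: "'x \<times> 'x \<Rightarrow> bool" assume "eventually P uniformity"
    then have "{p. P p} \<in> vicinities" by (simp add: vicinities_def)
    then obtain V where V: "V \<in> vicinities" and sym: "sym V" and sub: "V O V O V \<subseteq> {p. P p}"
      by (rule vicinity_third)
    have tri: "(x, w) \<in> {p. P p}" if "(x, y) \<in> V" "(y, z) \<in> V" "(z, w) \<in> V" for x y z w
      using sub that by blast
    obtain X where X: "finite X" "\<And>s. s \<in> R \<Longrightarrow> \<exists>x\<in>X. (x, s) \<in> V"
      using tb[unfolded totally_bounded_def, rule_format, OF V[unfolded vicinities_def mem_Collect_eq]]
      by blast
    have "\<exists>x\<in>X. eventually (\<lambda>i. (x, a i) \<in> V) H"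
    proof (rule ccontr)
      assume "\<not> ?thesis"
      then have "eventually (\<lambda>i. \<forall>x\<in>X. (x, a i) \<notin> V) H"
        using ultra X(1) by (auto intro!: eventually_ball_finite)
      moreover have "\<not> (\<forall>x\<in>X. (x, a i) \<notin> V)" for i using X(2) aR by blast
      ultimately show False using \<open>H \<noteq> bot\<close> by (simp add: trivial_limit_def)
    qed
    then obtain x where x: "eventually (\<lambda>i. (x, a i) \<in> V) H" by blast
    have "P (y, z)" if "(x, y) \<in> V" "(x, z) \<in> V" for y z
      using tri[OF symD[OF sym, OF that(1)] that(2) vicinity_refl[OF V]] by simp
    then show "eventually P (filtermap a H \<times>\<^sub>F filtermap a H)"
      unfolding eventually_prod_same eventually_filtermap
      using x by (intro exI[of _ "\<lambda>y. (x, y) \<in> V"]) auto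
  qed
  moreover have "filtermap a H \<le> principal M"
    using aR RM by (auto simp: le_principal eventually_filtermap intro!: always_eventually)
  moreover have "filtermap a H \<noteq> bot" using \<open>H \<noteq> bot\<close> by (simp add: filtermap_bot_iff)
  ultimately obtain x where x: "x \<in> M" "filtermap a H \<le> nhds x"
    using M unfolding complete_uniform by blast
  have "eventually (\<lambda>i. (x, a i) \<in> U) H" if "U \<in> vicinities" for U
    using filter_leD[OF x(2) eventually_nhds_vicinity[OF that]]
    by (simp add: eventually_filtermap)
  with x(1) show ?thesis by blast
qed

text \<open>
  On a totally bounded set in a complete one, a countable family of vicinities with the right
  intersection on \<open>M\<close> yields a countable base. Otherwise there are pairs outside some vicinity
  \<open>U\<close> which are close with respect to more and more members; a limit pair lies in all members,
  hence in every vicinity, contrary to the pairs staying outside \<open>U\<close>. Passing to a limit costs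
  one step at either end of a pair, whence the base is made of finite intersections of thirds of
  the given vicinities.
\<close>

lemma countable_base_of_vN_countability:
  fixes M R :: "'x::uniform_space set"
  assumes "totally_bounded R" "R \<subseteq> M" "complete M" "vN_countability M"
  obtains W :: "nat \<Rightarrow> ('x \<times> 'x) set" where "\<And>n. W n \<in> vicinities"
    "\<And>U. U \<in> vicinities \<Longrightarrow> \<exists>n. (R \<times> R) \<inter> W n \<subseteq> U"
proof -
  obtain B :: "nat \<Rightarrow> ('x \<times> 'x) set" where B: "\<And>n. B n \<in> vicinities"
    and BM: "(M \<times> M) \<inter> (\<Inter>n. B n) = (M \<times> M) \<inter> \<Inter>vicinities"
    using assms(4) unfolding vN_countability_def by blast
  have "\<forall>n. \<exists>V. V \<in> vicinities \<and> sym V \<and> V O V O V \<subseteq> B n"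
    using vicinity_third[OF B] by metis
  then obtain V where V: "\<And>n. V n \<in> vicinities" and symV: "\<And>n. sym (V n)"
    and subV: "\<And>n. V n O V n O V n \<subseteq> B n"
    by metis
  define W where "W n = (\<Inter>i\<le>n. V i)" for n
  show thesis
  proof
    show "W n \<in> vicinities" for n unfolding W_def by (rule vicinity_Int_atMost[OF V])
    fix U :: "('x \<times> 'x) set" assume "U \<in> vicinities"
    then obtain T where T: "T \<in> vicinities" and symT: "sym T" and subT: "T O T O T \<subseteq> U"
      by (rule vicinity_third)
    have triT: "(x, w) \<in> U" if "(x, y) \<in> T" "(y, z) \<in> T" "(z, w) \<in> T" for x y z w
      using subT that by blast
    show "\<exists>n. (R \<times> R) \<inter> W n \<subseteq> U"
    proof (rule ccontr)
      assume "\<not> ?thesis"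
      then have "\<forall>n. \<exists>p. fst p \<in> R \<and> snd p \<in> R \<and> p \<in> W n \<and> p \<notin> U" by fastforce
      then obtain p where p: "\<And>n. fst (p n) \<in> R" "\<And>n. snd (p n) \<in> R" "\<And>n. p n \<in> W n" "\<And>n. p n \<notin> U"
        by metis
      \<comment> \<open>Choosing subsequences settles closeness for one vicinity at a time, so for countably many
        at best; an ultrafilter settles it for all vicinities at once.\<close>
      obtain H where H: "H \<le> sequentially" "H \<noteq> bot"
        and ultra: "\<And>P. eventually P H \<or> eventually (\<lambda>n::nat. \<not> P n) H"
        using ultrafilter_below[OF sequentially_bot] by metis
      obtain x where x: "x \<in> M" "\<And>U. U \<in> vicinities \<Longrightarrow> eventually (\<lambda>n. (x, fst (p n)) \<in> U) H"
        using ultrafilter_converges[where a = "\<lambda>n. fst (p n)", OF H(2) ultra assms(1) p(1) assms(2,3)]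
        by blast
      obtain y where y: "y \<in> M" "\<And>U. U \<in> vicinities \<Longrightarrow> eventually (\<lambda>n. (y, snd (p n)) \<in> U) H"
        using ultrafilter_converges[where a = "\<lambda>n. snd (p n)", OF H(2) ultra assms(1) p(2) assms(2,3)]
        by blast
      have "(x, y) \<in> B n" for n
      proof -
        have "eventually (\<lambda>m. m \<ge> n) H" using H(1) eventually_ge_at_top filter_leD by blast
        then have "eventually (\<lambda>m. (x, y) \<in> B n) H"
          using x(2)[OF V[of n]] y(2)[OF V[of n]]
        proof eventually_elim
          case (elim m)
          have "(fst (p m), snd (p m)) \<in> V n" using p(3)[of m] elim(1) by (auto simp: W_def)
          then show ?case using subV[of n] elim(2) symD[OF symV elim(3)] by blast
        qed
        then show ?thesis using H(2) by simp
      qed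
      then have xy: "(x, y) \<in> T" using BM x(1) y(1) T by blast
      have "eventually (\<lambda>m. p m \<in> U) H"
        using x(2)[OF T] y(2)[OF T]
      proof eventually_elim
        case (elim m)
        have "(fst (p m), x) \<in> T" using elim(1) symT by (rule symD[rotated])
        then have "(fst (p m), snd (p m)) \<in> U" using xy elim(2) by (rule triT)
        then show ?case by simp
      qed
      then show False using p(4) H(2) by simp
    qed
  qed
qed

section \<open>Totally bounded families of functions\<close>

definition totally_bounded_family :: "('i \<Rightarrow> 't \<Rightarrow> 'x::uniform_space) \<Rightarrow> bool" where
  "totally_bounded_family F \<longleftrightarrow>
     (\<forall>U\<in>vicinities. \<exists>C. finite C \<and> (\<forall>u. \<exists>c\<in>C. \<forall>t. (F c t, F u t) \<in> U))"

text \<open>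
  A finite cover by small sets is conveniently given by a map to finitely many labels, the sets
  being its fibres; a common refinement of covers is then a tuple of labels.
\<close>

lemma totally_bounded_familyI:
  fixes F :: "'i \<Rightarrow> 't \<Rightarrow> 'x::uniform_space"
  assumes "\<And>U. U \<in> vicinities \<Longrightarrow>
    \<exists>l :: 'i \<Rightarrow> 'l. finite (range l) \<and> (\<forall>u v. l u = l v \<longrightarrow> (\<forall>t. (F u t, F v t) \<in> U))"
  shows "totally_bounded_family F"
  unfolding totally_bounded_family_def
proof
  fix U :: "('x \<times> 'x) set" assume "U \<in> vicinities"
  then obtain l :: "'i \<Rightarrow> 'l" where l: "finite (range l)" "\<And>u v t. l u = l v \<Longrightarrow> (F u t, F v t) \<in> U"
    using assms by blast
  have "l (inv l (l u)) = l u" for u by (rule f_inv_into_f) simp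
  then have "(F (inv l (l u)) t, F u t) \<in> U" for u t by (rule l(2))
  then show "\<exists>C. finite C \<and> (\<forall>u. \<exists>c\<in>C. \<forall>t. (F c t, F u t) \<in> U)"
    using l(1) by (intro exI[of _ "inv l ` range l"]) blast
qed

text \<open>
  Conversely, labelling each parameter by a nearby centre gives small fibres, since two
  parameters with the same centre are close to each other.
\<close>

lemma totally_bounded_family_centres:
  fixes F :: "'i \<Rightarrow> 't \<Rightarrow> 'x::uniform_space"
  assumes "totally_bounded_family F" "U \<in> vicinities"
  shows "\<exists>c. finite (range c) \<and> (\<forall>u t. (F u t, F (c u) t) \<in> U) \<and>
    (\<forall>u v. c u = c v \<longrightarrow> (\<forall>t. (F u t, F v t) \<in> U))"
proof -
  obtain V where V: "V \<in> vicinities" and sym: "sym V" and sub: "V O V O V \<subseteq> U"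
    using assms(2) by (rule vicinity_third)
  have tri: "(x, w) \<in> U" if "(x, y) \<in> V" "(y, z) \<in> V" "(z, w) \<in> V" for x y z w
    using sub that by blast
  obtain C where C: "finite C" "\<forall>u. \<exists>c\<in>C. \<forall>t. (F c t, F u t) \<in> V"
    using bspec[OF assms(1)[unfolded totally_bounded_family_def] V] by (elim exE conjE)
  obtain c where c: "\<forall>u. c u \<in> C \<and> (\<forall>t. (F (c u) t, F u t) \<in> V)"
    using bchoice[of UNIV "\<lambda>u c. c \<in> C \<and> (\<forall>t. (F c t, F u t) \<in> V)"] C(2) by (auto simp: Bex_def)
  then have cC: "c u \<in> C" and cV: "(F (c u) t, F u t) \<in> V" for u t by auto
  show ?thesis
  proof (intro exI conjI allI impI)
    show "finite (range c)" by (rule finite_subset[OF _ C(1)]) (use cC in auto)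
    show "(F u t, F (c u) t) \<in> U" for u t
      using tri[OF symD[OF sym, OF cV] vicinity_refl[OF V] vicinity_refl[OF V]] .
    show "(F u t, F v t) \<in> U" if "c u = c v" for u v t
      using tri[OF symD[OF sym, OF cV] vicinity_refl[OF V]] cV[of v t] that by simp
  qed
qed

lemma totally_bounded_values:
  fixes F :: "'i \<Rightarrow> 't \<Rightarrow> 'x::uniform_space"
  assumes "totally_bounded_family F"
  shows "totally_bounded (range (\<lambda>u. F u t))"
  unfolding totally_bounded_def
proof (intro allI impI)
  fix E :: "'x \<times> 'x \<Rightarrow> bool" assume "eventually E uniformity"
  then have E: "{p. E p} \<in> vicinities" by (simp add: vicinities_def)
  obtain C where C: "finite C" "\<forall>u. \<exists>c\<in>C. \<forall>t. (F c t, F u t) \<in> {p. E p}"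
    using bspec[OF assms[unfolded totally_bounded_family_def] E] by (elim exE conjE)
  show "\<exists>X. finite X \<and> (\<forall>s\<in>range (\<lambda>u. F u t). \<exists>x\<in>X. E (x, s))"
  proof (intro exI conjI ballI)
    show "finite ((\<lambda>u. F u t) ` C)" using C(1) by simp
    fix s assume "s \<in> range (\<lambda>u. F u t)"
    then obtain u where "s = F u t" by blast
    with C(2) show "\<exists>x\<in>(\<lambda>u. F u t) ` C. E (x, s)" by blast
  qed
qed

text \<open>
  If finitely many centres never suffice for \<open>U\<close>, each new member of a sequence can be chosen
  \<open>U\<close>-far from all earlier ones, and such a sequence has no Cauchy subsequence.
\<close>

lemma totally_bounded_family_if_subseq:
  fixes F :: "'i \<Rightarrow> 't::topological_space \<Rightarrow> 'x::uniform_space"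
  assumes "\<And>s :: nat \<Rightarrow> 'i. has_Cauchy_subseq (\<lambda>n. F (s n))"
  shows "totally_bounded_family F"
proof (rule ccontr)
  assume "\<not> ?thesis"
  then have "\<exists>U\<in>vicinities. \<forall>C. finite C \<longrightarrow> (\<exists>u. \<forall>c\<in>C. \<exists>t. (F c t, F u t) \<notin> U)"
    by (simp add: totally_bounded_family_def)
  then obtain U where U: "U \<in> vicinities"
    and far: "\<forall>C. finite C \<longrightarrow> (\<exists>u. \<forall>c\<in>C. \<exists>t. (F c t, F u t) \<notin> U)" by (elim bexE)
  have "\<exists>s :: nat \<Rightarrow> 'i. \<forall>n. \<forall>m<n. \<exists>t. (F (s m) t, F (s n) t) \<notin> U"
  proof (rule dependent_wellorder_choice)
    fix n :: nat and s :: "nat \<Rightarrow> 'i"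
    show "\<exists>u. \<forall>m<n. \<exists>t. (F (s m) t, F u t) \<notin> U"
      using far[rule_format, of "s ` {..<n}"] by (simp, simp add: Ball_def)
  qed simp
  then obtain s :: "nat \<Rightarrow> 'i" where s: "\<forall>n. \<forall>m<n. \<exists>t. (F (s m) t, F (s n) t) \<notin> U" ..
  obtain r :: "nat \<Rightarrow> nat" where r: "strict_mono r" "Cauchy_contfuns ((\<lambda>n. F (s n)) \<circ> r)"
    using assms[of s] unfolding has_Cauchy_subseq_def by (elim exE conjE)
  obtain N where "\<forall>m\<ge>N. \<forall>n\<ge>N. (((\<lambda>n. F (s n)) \<circ> r) m, ((\<lambda>n. F (s n)) \<circ> r) n) \<in> basic_vicinity U"
    using bspec[OF r(2)[unfolded Cauchy_contfuns_iff] U] ..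
  from this[rule_format, of N "Suc N"]
  have "\<forall>t. (F (s (r N)) t, F (s (r (Suc N))) t) \<in> U"
    by (simp add: basic_vicinity_def)
  moreover have "r N < r (Suc N)" using r(1) by (simp add: strict_mono_Suc_iff)
  ultimately show False using s by blast
qed

text \<open>
  For the \<open>n\<close>-th vicinity of the countable base the pigeonhole principle gives a subsequence whose
  members are pairwise that close; the diagonal sequence works for all \<open>n\<close>.
\<close>

lemma subseq_if_totally_bounded_family:
  fixes F :: "'i \<Rightarrow> 't::topological_space \<Rightarrow> 'x::uniform_space" and s :: "nat \<Rightarrow> 'i"
  assumes tb: "totally_bounded_family F" and cont: "\<And>u. F u \<in> contfuns"
    and R: "\<And>u t. F u t \<in> R" and W: "\<And>n::nat. W n \<in> vicinities"
    and base: "\<And>U. U \<in> vicinities \<Longrightarrow> \<exists>n. (R \<times> R) \<inter> W n \<subseteq> U"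
  shows "has_Cauchy_subseq (\<lambda>n. F (s n))"
proof -
  define P where "P n r \<longleftrightarrow> (\<forall>i j t. (F (s (r i)) t, F (s (r j)) t) \<in> W n)" for n and r :: "nat \<Rightarrow> nat"
  interpret subseqs P
  proof
    fix n and q :: "nat \<Rightarrow> nat"
    obtain c :: "'i \<Rightarrow> 'i" where c: "finite (range c)"
      "\<forall>u v. c u = c v \<longrightarrow> (\<forall>t. (F u t, F v t) \<in> W n)"
      using totally_bounded_family_centres[OF tb W[of n]] by blast
    have "finite (range (\<lambda>k. c (s (q k))))" by (rule finite_subset[OF _ c(1)]) auto
    then obtain k where k: "infinite {i. c (s (q i)) = c (s (q k))}"
      using pigeonhole_infinite[of "UNIV :: nat set" "\<lambda>k. c (s (q k))"] by auto
    obtain r :: "nat \<Rightarrow> nat" where r: "strict_mono r" "\<And>i. r i \<in> {i. c (s (q i)) = c (s (q k))}"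
      using infinite_enumerate[OF k] by blast
    then have "P n (q \<circ> r)" unfolding P_def by (auto intro!: c(2)[rule_format])
    with r(1) show "\<exists>r. strict_mono r \<and> P n (q \<circ> r)" by (intro exI conjI)
  qed
  have "Cauchy_contfuns ((\<lambda>n. F (s n)) \<circ> diagseq)"
    unfolding Cauchy_contfuns_iff
  proof
    fix U :: "('x \<times> 'x) set" assume "U \<in> vicinities"
    then obtain n where n: "(R \<times> R) \<inter> W n \<subseteq> U" using base by blast
    have Pn: "P n (diagseq \<circ> (+) (Suc n))" by (rule diagseq_holds) (simp add: P_def)
    have "(F (s (diagseq i)) t, F (s (diagseq j)) t) \<in> U" if "Suc n \<le> i" "Suc n \<le> j" for i j t
      using Pn[THEN P_def[THEN iffD1], rule_format, of "i - Suc n" t "j - Suc n"] that n R by auto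
    then show "\<exists>N. \<forall>i\<ge>N. \<forall>j\<ge>N.
        (((\<lambda>n. F (s n)) \<circ> diagseq) i, ((\<lambda>n. F (s n)) \<circ> diagseq) j) \<in> basic_vicinity U"
      unfolding basic_vicinity_def using cont by auto
  qed
  with subseq_diagseq show ?thesis unfolding has_Cauchy_subseq_def by blast
qed

section \<open>Translates\<close>

text \<open>
  The operation \<open>p\<close> is the group operation for left translates and its opposite for right ones.
  The label of \<open>u\<close> records, for each of the finitely many centres \<open>d\<close> of the one-sided family, the
  centre near \<open>p d u\<close>.
\<close>

lemma totally_bounded_family_two_sided:
  fixes p :: "'g \<Rightarrow> 'g \<Rightarrow> 'g" and f :: "'g \<Rightarrow> 'x::uniform_space"
  assumes assoc: "\<And>x y z. p (p x y) z = p x (p y z)"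
    and tb: "totally_bounded_family (\<lambda>a t. f (p a t))"
  shows "totally_bounded_family (\<lambda>a (s, t). f (p (p s a) t))"
proof (rule totally_bounded_familyI)
  fix U :: "('x \<times> 'x) set" assume "U \<in> vicinities"
  then obtain V where V: "V \<in> vicinities" and sym: "sym V" and sub: "V O V O V \<subseteq> U"
    by (rule vicinity_third)
  have tri: "(x, w) \<in> U" if "(x, y) \<in> V" "(y, z) \<in> V" "(z, w) \<in> V" for x y z w
    using sub that by blast
  obtain c where c: "finite (range c)" "\<forall>u t. (f (p u t), f (p (c u) t)) \<in> V"
    "\<forall>u v. c u = c v \<longrightarrow> (\<forall>t. (f (p u t), f (p v t)) \<in> V)"
    using totally_bounded_family_centres[OF tb V] by (elim exE conjE)
  define l where "l u = (\<lambda>d\<in>range c. c (p d u))" for u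
  have "range l \<subseteq> range c \<rightarrow>\<^sub>E range c" by (auto simp: l_def)
  then have "finite (range l)" using c(1) finite_PiE[of "range c" "\<lambda>_. range c"] finite_subset by blast
  moreover have "(f (p (p s u) t), f (p (p s v) t)) \<in> U" if "l u = l v" for u v s t
  proof (rule tri)
    show "(f (p (p s u) t), f (p (c s) (p u t))) \<in> V" unfolding assoc by (rule c(2)[rule_format])
    show "(f (p (c s) (p v t)), f (p (p s v) t)) \<in> V"
      unfolding assoc by (rule symD[OF sym c(2)[rule_format]])
    have "c (p (c s) u) = c (p (c s) v)" using fun_cong[OF that, of "c s"] by (simp add: l_def)
    then show "(f (p (c s) (p u t)), f (p (c s) (p v t))) \<in> V"
      unfolding assoc[symmetric] by (rule c(3)[rule_format])
  qed
  ultimately show "\<exists>l :: 'g \<Rightarrow> 'g \<Rightarrow> 'g. finite (range l) \<and> (\<forall>u v. l u = l v \<longrightarrow>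
      (\<forall>t. (case t of (s, t) \<Rightarrow> f (p (p s u) t), case t of (s, t) \<Rightarrow> f (p (p s v) t)) \<in> U))"
    by (intro exI[of _ l]) auto
qed

text \<open>
  Maak's classes may overlap; choosing one of them for each parameter gives a labelling, and
  conversely the fibres of a labelling serve as classes.
\<close>

lemma AP_iff_totally_bounded_family:
  fixes f :: "'g::topological_group_add \<Rightarrow> 'x::uniform_space"
  shows "f \<in> AP \<longleftrightarrow> f \<in> contfuns \<and> totally_bounded_family (\<lambda>a. mtranslate a f)"
proof (intro iffI conjI)
  assume f: "f \<in> AP"
  then show "f \<in> contfuns" by (simp add: AP_def)
  show "totally_bounded_family (\<lambda>a. mtranslate a f)"
  proof (rule totally_bounded_familyI)
    fix U :: "('x \<times> 'x) set" assume U: "U \<in> vicinities"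
    have "\<forall>U\<in>vicinities. \<exists>(n::nat) A. (\<Union>j\<in>{1..n}. A j) = UNIV \<and>
        (\<forall>k\<in>{1..n}. \<forall>u\<in>A k. \<forall>v\<in>A k. \<forall>s t. (f (s + u + t), f (s + v + t)) \<in> U)"
      using f by (simp add: AP_def)
    from bspec[OF this U] obtain n :: nat and A where cover: "(\<Union>j\<in>{1..n}. A j) = UNIV"
      and A: "\<forall>k\<in>{1..n}. \<forall>u\<in>A k. \<forall>v\<in>A k. \<forall>s t. (f (s + u + t), f (s + v + t)) \<in> U"
      by (elim exE conjE)
    define l where "l u = (SOME j. j \<in> {1..n} \<and> u \<in> A j)" for u
    have l: "l u \<in> {1..n} \<and> u \<in> A (l u)" for u
    proof -
      have "\<exists>j. j \<in> {1..n} \<and> u \<in> A j" using cover by blast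
      then show ?thesis unfolding l_def by (rule someI_ex)
    qed
    show "\<exists>l :: 'g \<Rightarrow> nat. finite (range l) \<and> (\<forall>u v. l u = l v \<longrightarrow>
        (\<forall>t. (mtranslate u f t, mtranslate v f t) \<in> U))"
    proof (intro exI conjI allI impI)
      show "finite (range l)" by (rule finite_subset[of _ "{1..n}"]) (use l in auto)
      fix u v :: 'g and t :: "'g \<times> 'g" assume "l u = l v"
      then have "v \<in> A (l u)" using l[of v] by simp
      then show "(mtranslate u f t, mtranslate v f t) \<in> U"
        using A[rule_format, of "l u" u v] l[of u] by (simp add: mtranslate_def case_prod_unfold)
    qed
  qed
next
  assume "f \<in> contfuns \<and> totally_bounded_family (\<lambda>a. mtranslate a f)"
  then have f: "f \<in> contfuns" and tb: "totally_bounded_family (\<lambda>a. mtranslate a f)" by auto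
  have "\<exists>(n::nat) A. (\<Union>j\<in>{1..n}. A j) = UNIV \<and>
      (\<forall>k\<in>{1..n}. \<forall>u\<in>A k. \<forall>v\<in>A k. \<forall>s t. (f (s + u + t), f (s + v + t)) \<in> U)"
    if U: "U \<in> vicinities" for U
  proof -
    obtain c :: "'g \<Rightarrow> 'g" where c: "finite (range c)"
      "\<forall>u v. c u = c v \<longrightarrow> (\<forall>t. (mtranslate u f t, mtranslate v f t) \<in> U)"
      using totally_bounded_family_centres[OF tb U] by blast
    obtain h where h: "bij_betw h {1..card (range c)} (range c)"
      using ex_bij_betw_nat_finite_1[OF c(1)] by blast
    have "(\<Union>j\<in>{1..card (range c)}. {u. c u = h j}) = UNIV"
      using bij_betw_imp_surj_on[OF h] by blast
    moreover have "(f (s + u + t), f (s + v + t)) \<in> U" if "c u = c v" for u v s t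
      using c(2)[rule_format, OF that, of "(s, t)"] by (simp add: mtranslate_def)
    ultimately show ?thesis
      by (intro exI[of _ "card (range c)"] exI[of _ "\<lambda>j. {u. c u = h j}"]) auto
  qed
  with f show "f \<in> AP" by (simp add: AP_def)
qed

lemma translates_contfuns:
  assumes "f \<in> contfuns"
  shows "ltranslate a f \<in> contfuns" "rtranslate a f \<in> contfuns" "mtranslate a f \<in> contfuns"
  using assms unfolding contfuns_def ltranslate_def rtranslate_def mtranslate_def case_prod_unfold
  by (auto intro!: continuous_on_compose2[of UNIV f] continuous_intros)

lemma AP_if_Lssap:
  assumes "Lssap f"
  shows "f \<in> AP"
proof -
  have "totally_bounded_family (\<lambda>a. ltranslate a f)"
    using assms unfolding Lssap_def by (intro totally_bounded_family_if_subseq) blast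
  then have "totally_bounded_family (\<lambda>a (s, t). f (s + a + t))"
    unfolding ltranslate_def by (intro totally_bounded_family_two_sided) (simp_all add: add.assoc)
  with assms show ?thesis
    unfolding AP_iff_totally_bounded_family mtranslate_def Lssap_def by simp
qed

lemma AP_if_Rssap:
  fixes f :: "'g::topological_group_add \<Rightarrow> 'x::uniform_space"
  assumes "Rssap f"
  shows "f \<in> AP"
proof -
  have "totally_bounded_family (\<lambda>a. rtranslate a f)"
    using assms unfolding Rssap_def by (intro totally_bounded_family_if_subseq) blast
  then have tb: "totally_bounded_family (\<lambda>a (s, t). f (t + (a + s)))"
    unfolding rtranslate_def
    by (intro totally_bounded_family_two_sided[where p = "\<lambda>x y. y + x"]) (simp_all add: add.assoc)
  \<comment> \<open>The opposite operation exchanges the two outer variables.\<close>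
  have "totally_bounded_family (\<lambda>a. mtranslate a f)"
    unfolding totally_bounded_family_def
  proof
    fix U :: "('x \<times> 'x) set" assume "U \<in> vicinities"
    then show "\<exists>C. finite C \<and> (\<forall>u. \<exists>c\<in>C. \<forall>t. (mtranslate c f t, mtranslate u f t) \<in> U)"
      using tb unfolding totally_bounded_family_def mtranslate_def split_paired_All prod.case add.assoc
      by meson
  qed
  with assms show ?thesis unfolding AP_iff_totally_bounded_family Rssap_def by simp
qed

text \<open>
  Uniform closeness passes to the values along any map \<open>\<phi>\<close>. With \<open>\<phi> t = (0, t)\<close> and
  \<open>\<phi> t = (t, 0)\<close> this restricts two-sided translates to one-sided ones.
\<close>

lemma has_Cauchy_subseq_reindex:
  assumes "has_Cauchy_subseq F" "\<And>n. F' n \<in> contfuns" "\<And>n t. F' n t = F n (\<phi> t)"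
  shows "has_Cauchy_subseq F'"
  using assms unfolding has_Cauchy_subseq_def Cauchy_contfuns_iff basic_vicinity_def
  by (simp, meson)

lemma Lssap_if_ssap:
  fixes f :: "'g::topological_group_add \<Rightarrow> 'x::uniform_space"
  assumes "ssap f"
  shows "Lssap f"
  unfolding Lssap_def
proof (intro conjI allI)
  show f: "f \<in> contfuns" using assms by (simp add: ssap_def)
  show "has_Cauchy_subseq (\<lambda>n. ltranslate (s n) f)" for s :: "nat \<Rightarrow> 'g"
    using assms translates_contfuns[OF f] unfolding ssap_def
    by (intro has_Cauchy_subseq_reindex[where F = "\<lambda>n. mtranslate (s n) f" and \<phi> = "\<lambda>t. (0, t)"])
       (auto simp: ltranslate_def mtranslate_def)
qed

lemma Rssap_if_ssap:
  fixes f :: "'g::topological_group_add \<Rightarrow> 'x::uniform_space"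
  assumes "ssap f"
  shows "Rssap f"
  unfolding Rssap_def
proof (intro conjI allI)
  show f: "f \<in> contfuns" using assms by (simp add: ssap_def)
  show "has_Cauchy_subseq (\<lambda>n. rtranslate (s n) f)" for s :: "nat \<Rightarrow> 'g"
    using assms translates_contfuns[OF f] unfolding ssap_def
    by (intro has_Cauchy_subseq_reindex[where F = "\<lambda>n. mtranslate (s n) f" and \<phi> = "\<lambda>t. (t, 0)"])
       (auto simp: rtranslate_def mtranslate_def)
qed

lemma ssap_if_AP:
  fixes f :: "'g::topological_group_add \<Rightarrow> 'x::uniform_space"
  assumes "f \<in> AP" "range f \<subseteq> M" "complete M" "vN_countability M"
  shows "ssap f"
proof -
  from assms(1) have f: "f \<in> contfuns" and tb: "totally_bounded_family (\<lambda>a. mtranslate a f)"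
    by (auto simp: AP_iff_totally_bounded_family)
  have "totally_bounded (range f)"
    using totally_bounded_values[OF tb, of "(0, 0)"] by (simp add: mtranslate_def)
  then obtain W :: "nat \<Rightarrow> ('x \<times> 'x) set" where W: "\<And>n. W n \<in> vicinities"
    "\<And>U. U \<in> vicinities \<Longrightarrow> \<exists>n. (range f \<times> range f) \<inter> W n \<subseteq> U"
    using countable_base_of_vN_countability[OF _ assms(2-4)] by metis
  have "mtranslate a f t \<in> range f" for a t by (simp add: mtranslate_def case_prod_unfold)
  then have "has_Cauchy_subseq (\<lambda>n. mtranslate (s n) f)" for s :: "nat \<Rightarrow> 'g"
    using subseq_if_totally_bounded_family[OF tb translates_contfuns(3)[OF f] _ W] by blast
  with f show ?thesis by (simp add: ssap_def)
qed

theorem corollary4p11: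
  fixes f :: "'g::topological_group_add \<Rightarrow> 'x::uniform_space"
    and M :: "'x set"
  assumes "f \<in> contfuns"
    and "range f \<subseteq> M"
    and "complete M"
    and "vN_countability M"
  shows "(ssap f \<longleftrightarrow> f \<in> AP) \<and> (LRssap f \<longleftrightarrow> f \<in> AP) \<and>
         (Lssap f \<longleftrightarrow> f \<in> AP) \<and> (Rssap f \<longleftrightarrow> f \<in> AP)"
  unfolding LRssap_def
  using ssap_if_AP[OF _ assms(2-4)] Lssap_if_ssap Rssap_if_ssap AP_if_Lssap AP_if_Rssap by blast

end
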